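(* Let $F=(F_1,\dots,F_n)^T:\mathbb{R}^n\to\mathbb{R}^n$ be monotone, $L$-Lipschitz continuous, and componentwise Lipschitz continuous with constants $l_1,\dots,l_n>0$, and let $l_{\max}=\max_{1\le i\le n} l_i$. Let $\Omega\subseteq\mathbb{R}^n$ be nonempty, closed and convex, let $\boldsymbol{x}^*\in\Omega$ satisfy $F(\boldsymbol{x}^* )=\boldsymbol{0}$, and let $\rho\in(0,1)$, $\gamma\ge0$. Let $\{\boldsymbol{x}_k\}_{k\ge0}$, $\{\boldsymbol{y}_k\}_{k\ge0}$ be the random sequences generated by the Watchdog-Max method (defined in the context) from a deterministic initial point $\boldsymbol{x}_0\in\mathbb{R}^n$. Then for every integer $K\ge0$, $$\min_{0\le k\le K}\mathbb{E}\left[\frac{\|F^2(\boldsymbol{x}_k)\|_{[\gamma]}^2}{\|F(\boldsymbol{x}_k)\|^2}\right]\;\le\;\frac{\big(\sum_{i=1}^n l_i^\gamma\big)(l_{\max}+\rho L)^2}{\rho^2(1-\rho)^2(K+1)}\,\|\boldsymbol{x}_0-\boldsymbol{x}^*\|^2 ,$$ and furthermore $$\liminf_{k\to\infty}\mathbb{E}\big[\|F(\boldsymbol{x}_k)\|\big]=0 .$$ Here the expectation of a quantity depending on $\boldsymbol{x}_k$ is taken over the random indices $i_1^r,\dots,i_{k-1}^r$ drawn by the method before $\boldsymbol{x}_k$ is formed.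
   Context: $\|\cdot\|$ is the Euclidean norm, $e_i$ the $i$-th standard basis vector, $P_\Omega$ the Euclidean projection onto $\Omega$. Monotone: $\langle F(\boldsymbol{x})-F(\boldsymbol{y}),\boldsymbol{x}-\boldsymbol{y}\rangle\ge0$ for all $\boldsymbol{x},\boldsymbol{y}\in\mathbb{R}^n$. $L$-Lipschitz: $\|F(\boldsymbol{x})-F(\boldsymbol{y})\|\le L\|\boldsymbol{x}-\boldsymbol{y}\|$ for all $\boldsymbol{x},\boldsymbol{y}\in\mathbb{R}^n$. Componentwise Lipschitz with constants $l_1,\dots,l_n>0$: $|F_i(\boldsymbol{x}+te_i)-F_i(\boldsymbol{x})|\le l_i|t|$ for all $i$, all $\boldsymbol{x}\in\mathbb{R}^n$, $t\in\mathbb{R}$. Notation: $F^2(\boldsymbol{x})=[F_1(\boldsymbol{x})^2,\dots,F_n(\boldsymbol{x})^2]^T$, and $\|\boldsymbol{x}\|_{[\gamma]}=\sqrt{\sum_{i=1}^n l_i^\gamma x_i^2}$; thus $\|F^2(\boldsymbol{x})\|_{[\gamma]}^2=\sum_{i=1}^n l_i^\gamma F_i(\boldsymbol{x})^4$. The ratio $\|F^2(\boldsymbol{x})\|_{[\gamma]}^2/\|F(\boldsymbol{x})\|^2$ is read as $0$ when $F(\boldsymbol{x})=\boldsymbol{0}$. Watchdog-Max method: given $\boldsymbol{x}_0\in\mathbb{R}^n$, choose $i_0\in\arg\max_{1\le i\le n}|F_i(\boldsymbol{x}_0)|$. For each $k\ge1$, draw $i_k^r\in\{1,\dots,n\}$,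 independently across iterations, with $\Pr(i_k^r=i)=l_i^\gamma/\sum_{j=1}^n l_j^\gamma$, and let $i_k\in\{i_{k-1},i_k^r\}$ be an index attaining $\max\{|F_{i_{k-1}}(\boldsymbol{x}_k)|,|F_{i_k^r}(\boldsymbol{x}_k)|\}$. Ties are broken by a fixed deterministic rule. For every $k\ge0$, $$\boldsymbol{y}_k=\boldsymbol{x}_k-\frac{\rho}{l_{i_k}}F_{i_k}(\boldsymbol{x}_k)e_{i_k},\qquad \boldsymbol{x}_{k+1}=P_\Omega\big(\boldsymbol{x}_k-\beta_kF(\boldsymbol{y}_k)\big),\qquad \beta_k=\frac{\rho\,F_{i_k}(\boldsymbol{y}_k)F_{i_k}(\boldsymbol{x}_k)}{l_{i_k}\|F(\boldsymbol{y}_k)\|^2},$$ with the convention $\beta_k=0$ if $F(\boldsymbol{y}_k)=\boldsymbol{0}$. *)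

theory Defs
  imports "HOL-Probability.Probability"
begin

definition monotone_operator :: "(real ^ 'n \<Rightarrow> real ^ 'n) \<Rightarrow> bool" where
  "monotone_operator F \<longleftrightarrow> (\<forall>x y. (F x - F y) \<bullet> (x - y) \<ge> 0)"

definition componentwise_lipschitz :: "('n \<Rightarrow> real) \<Rightarrow> (real ^ 'n \<Rightarrow> real ^ 'n) \<Rightarrow> bool" where
  "componentwise_lipschitz l F \<longleftrightarrow>
     (\<forall>i. l i > 0) \<and> (\<forall>i x t. \<bar>F (x + t *\<^sub>R axis i 1) $ i - F x $ i\<bar> \<le> l i * \<bar>t\<bar>)"

definition weighted_norm :: "('n::finite \<Rightarrow> real) \<Rightarrow> real \<Rightarrow> real ^ 'n \<Rightarrow> real" where
  "weighted_norm l \<gamma> x = sqrt (\<Sum>i\<in>UNIV. l i powr \<gamma> * (x $ i)\<^sup>2)"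

definition vec_square :: "real ^ 'n \<Rightarrow> real ^ 'n" where
  "vec_square v = (\<chi> i. (v $ i)\<^sup>2)"

text \<open>Equal to \<open>0\<close> when \<open>F x = 0\<close>, because division by zero yields zero.\<close>

definition residual_ratio ::
    "('n::finite \<Rightarrow> real) \<Rightarrow> real \<Rightarrow> (real ^ 'n \<Rightarrow> real ^ 'n) \<Rightarrow> real ^ 'n \<Rightarrow> real" where
  "residual_ratio l \<gamma> F x = (weighted_norm l \<gamma> (vec_square (F x)))\<^sup>2 / (norm (F x))\<^sup>2"

text \<open>A deterministic tie-breaking rule is encoded in a selection function: \<open>sel k x i j\<close> is
  the index chosen at iteration \<open>k\<close> and iterate \<open>x\<close> from the previous index \<open>i\<close> and the
  drawn index \<open>j\<close>. It is unconstrained beyond attaining the maximum, so every rule depending on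
  these data is covered.\<close>

definition max_selection ::
    "(real ^ 'n \<Rightarrow> real ^ 'n) \<Rightarrow> (nat \<Rightarrow> real ^ 'n \<Rightarrow> 'n \<Rightarrow> 'n \<Rightarrow> 'n) \<Rightarrow> bool" where
  "max_selection F sel \<longleftrightarrow>
     (\<forall>k x i j. sel k x i j \<in> {i, j} \<and> \<bar>F x $ sel k x i j\<bar> = max \<bar>F x $ i\<bar> \<bar>F x $ j\<bar>)"

text \<open>Equal to \<open>0\<close> when \<open>F y = 0\<close>, because division by zero yields zero.\<close>

definition step_size ::
    "(real ^ 'n \<Rightarrow> real ^ 'n) \<Rightarrow> ('n::finite \<Rightarrow> real) \<Rightarrow> real \<Rightarrow> 'n \<Rightarrow> real ^ 'n \<Rightarrow> real ^ 'n \<Rightarrow> real" where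
  "step_size F l \<rho> i x y = \<rho> * F y $ i * F x $ i / (l i * (norm (F y))\<^sup>2)"

text \<open>One realisation of the Watchdog-Max method: \<open>r\<close> holds the drawn indices (\<open>r 0\<close> is
  not used), \<open>ix\<close> the selected ones, \<open>i0\<close> is the choice of the initial maximiser.\<close>

definition watchdog_max_run ::
    "(real ^ 'n \<Rightarrow> real ^ 'n) \<Rightarrow> ('n::finite \<Rightarrow> real) \<Rightarrow> real \<Rightarrow> (real ^ 'n) set
      \<Rightarrow> (nat \<Rightarrow> real ^ 'n \<Rightarrow> 'n \<Rightarrow> 'n \<Rightarrow> 'n) \<Rightarrow> real ^ 'n \<Rightarrow> 'n
      \<Rightarrow> (nat \<Rightarrow> 'n) \<Rightarrow> (nat \<Rightarrow> 'n) \<Rightarrow> (nat \<Rightarrow> real ^ 'n) \<Rightarrow> (nat \<Rightarrow> real ^ 'n) \<Rightarrow> bool" where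
  "watchdog_max_run F l \<rho> \<Omega> sel x0 i0 r ix x y \<longleftrightarrow>
     x 0 = x0 \<and> ix 0 = i0 \<and>
     (\<forall>k\<ge>1. ix k = sel k (x k) (ix (k - 1)) (r k)) \<and>
     (\<forall>k. y k = x k - (\<rho> / l (ix k) * F (x k) $ ix k) *\<^sub>R axis (ix k) 1) \<and>
     (\<forall>k. x (Suc k) = closest_point \<Omega> (x k - step_size F l \<rho> (ix k) (x k) (y k) *\<^sub>R F (y k)))"

end

theory Submission
  imports Defs
begin

text \<open>
  The direction \<open>F y\<^sub>k\<close> separates \<open>x\<^sub>k\<close> from \<open>x\<^sup>*\<close>, and the step is the exact projection onto the
  separating hyperplane; hence \<open>\<parallel>x\<^sub>k - x\<^sup>*\<parallel>\<^sup>2\<close> drops by at least a constant times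
  \<open>F\<^sub>i(x\<^sub>k)\<^sup>4 / \<parallel>F(x\<^sub>k)\<parallel>\<^sup>2\<close>, where \<open>i\<close> is the selected index. By the maximum rule \<open>i\<close> may be replaced
  by the drawn index, which is independent of \<open>x\<^sub>k\<close>, so that averaging over it turns the fourth
  power into the residual ratio. Telescoping gives the rate and the summability of the expected
  ratios; the latter dominate \<open>(E \<parallel>F(x\<^sub>k)\<parallel>)\<^sup>2\<close> up to a constant, by Cauchy-Schwarz on \<open>\<real>\<^sup>n\<close> and on
  the probability space.
\<close>

section \<open>Decrease of the distance to a zero in a single step\<close>

text \<open>The step gains \<open>\<beta> * (a * g)\<close>, which is the square of
  \<open>\<rho> * g * f / (l i * norm (F y))\<close> when \<open>F y\<close> is nonzero.
  Componentwise Lipschitz continuity bounds \<open>g * f\<close> from below, and \<open>L\<close>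
  bounds \<open>norm (F y)\<close> from above by a multiple of \<open>norm (F x)\<close>.\<close>

lemma step_decrease:
  fixes F :: "real ^ 'n \<Rightarrow> real ^ 'n"
  assumes mono: "monotone_operator F"
    and lip: "L-lipschitz_on UNIV F"
    and cw: "componentwise_lipschitz l F"
    and \<Omega>: "closed \<Omega>" "convex \<Omega>" "z \<in> \<Omega>" and z: "F z = 0"
    and \<rho>: "0 < \<rho>" "\<rho> < 1"
    and y: "y = x - (\<rho> / l i * F x $ i) *\<^sub>R axis i 1"
    and x': "x' = closest_point \<Omega> (x - step_size F l \<rho> i x y *\<^sub>R F y)"
  shows "\<rho>\<^sup>2 * (1 - \<rho>)\<^sup>2 / (Max (range l) + \<rho> * L)\<^sup>2 * ((F x $ i) ^ 4 / (norm (F x))\<^sup>2)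
    \<le> (norm (x - z))\<^sup>2 - (norm (x' - z))\<^sup>2"
proof -
  define f g B where "f = F x $ i" and "g = F y $ i" and "B = Max (range l) + \<rho> * L"
  define a where "a = \<rho> / l i * f"
  define \<beta> where "\<beta> = step_size F l \<rho> i x y"
  have l: "l i > 0" using cw by (simp add: componentwise_lipschitz_def)
  have L: "L \<ge> 0" using lip by (rule lipschitz_on_nonneg)
  have lB: "l i + \<rho> * L \<le> B" unfolding B_def by simp
  have B: "B > 0" using lB l L \<rho>
    by (meson add_pos_nonneg less_eq_real_def less_le_trans mult_nonneg_nonneg)
  have y_a: "y = x - a *\<^sub>R axis i 1" by (simp add: y a_def f_def)
  \<comment> \<open>The factor \<open>\<rho> / l i\<close> in the coordinate step cancels
    \<open>l i\<close>, so the \<open>i\<close>-th component changes by at most the fraction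
    \<open>\<rho>\<close> of its size.\<close>
  have "\<bar>g - f\<bar> \<le> l i * \<bar>- a\<bar>"
    using cw unfolding componentwise_lipschitz_def g_def f_def y_a
    by (metis (no_types, lifting) diff_conv_add_uminus scaleR_minus_left)
  also have "\<dots> = \<rho> * \<bar>f\<bar>" using l \<rho> by (simp add: a_def abs_mult)
  finally have gf: "\<bar>g - f\<bar> \<le> \<rho> * \<bar>f\<bar>" .
  \<comment> \<open>Because \<open>\<rho> < 1\<close>, a nonzero \<open>i\<close>-th component keeps
    its sign from \<open>x\<close> to \<open>y\<close>; this makes \<open>\<beta>\<close>
    nonnegative.\<close>
  have "(f - g) * f \<le> \<bar>g - f\<bar> * \<bar>f\<bar>"
    by (metis abs_ge_self abs_minus_commute abs_mult)
  also have "\<dots> \<le> \<rho> * \<bar>f\<bar> * \<bar>f\<bar>" using gf by (rule mult_right_mono) simp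
  also have "\<dots> = \<rho> * f\<^sup>2" by (simp add: power2_eq_square)
  finally have fg: "(1 - \<rho>) * f\<^sup>2 \<le> g * f" by (simp add: algebra_simps power2_eq_square)
  have fg0: "0 \<le> g * f" using fg \<rho>
    by (meson diff_ge_0_iff_ge less_eq_real_def mult_nonneg_nonneg order_trans zero_le_power2)
  have ag0: "0 \<le> a * g" using fg0 \<rho> l by (simp add: a_def mult.commute mult.left_commute)
  \<comment> \<open>For \<open>F y = 0\<close> both sides vanish, so the identity also covers the
    default step size.\<close>
  have \<beta>: "\<beta> * (norm (F y))\<^sup>2 = a * g"
  proof (cases "F y = 0")
    case True then show ?thesis by (simp add: g_def)
  next
    case False then show ?thesis
      by (simp add: \<beta>_def step_size_def a_def f_def g_def field_simps)
  qed
  have \<beta>0: "\<beta> \<ge> 0"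
    unfolding \<beta>_def step_size_def using fg0 \<rho> l by (simp add: f_def g_def mult.assoc)
  have "F y \<bullet> (x - y) = a * g" by (simp add: y_a g_def inner_axis)
  moreover have "F y \<bullet> (y - z) \<ge> 0"
    using mono z unfolding monotone_operator_def by (metis diff_zero)
  ultimately have "a * g \<le> F y \<bullet> (x - z)" by (simp add: inner_diff_right)
  then have "\<beta> * (a * g) \<le> \<beta> * (F y \<bullet> (x - z))" using \<beta>0 by (rule mult_left_mono)
  moreover have "(norm (x - \<beta> *\<^sub>R F y - z))\<^sup>2
      = (norm (x - z))\<^sup>2 - 2 * (\<beta> * (F y \<bullet> (x - z))) + \<beta>\<^sup>2 * (norm (F y))\<^sup>2"
    unfolding power2_norm_eq_inner
    by (simp add: inner_diff_left inner_diff_right inner_commute power2_eq_square algebra_simps)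
  \<comment> \<open>The cross term contributes a decrease of at least
    \<open>2 * (\<beta> * (a * g))\<close>; this quadratic term gives back half of that
    bound.\<close>
  moreover have "\<beta>\<^sup>2 * (norm (F y))\<^sup>2 = \<beta> * (a * g)"
    by (simp add: \<beta>[symmetric] power2_eq_square)
  \<comment> \<open>Projection onto \<Omega> is nonexpansive and fixes \<open>z\<close>.\<close>
  moreover have "(norm (x' - z))\<^sup>2 \<le> (norm (x - \<beta> *\<^sub>R F y - z))\<^sup>2"
    using closest_point_lipschitz[of \<Omega> "x - \<beta> *\<^sub>R F y" z] \<Omega>
    by (auto simp: x' \<beta>_def closest_point_self dist_norm intro!: power_mono)
  ultimately have decr: "\<beta> * (a * g) \<le> (norm (x - z))\<^sup>2 - (norm (x' - z))\<^sup>2" by linarith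
  have "\<rho>\<^sup>2 * (1 - \<rho>)\<^sup>2 / B\<^sup>2 * (f ^ 4 / (norm (F x))\<^sup>2) \<le> \<beta> * (a * g)"
  proof (cases "F x = 0 \<or> F y = 0")
    case True
    then have "f = 0"
    proof
      assume "F y = 0"
      then have "(1 - \<rho>) * f\<^sup>2 \<le> 0" using fg by (simp add: g_def)
      then show "f = 0" using \<rho> by (simp add: mult_le_0_iff)
    qed (simp add: f_def)
    then show ?thesis using \<beta>0 ag0 by simp
  next
    case False
    then have nz: "norm (F x) > 0" "norm (F y) > 0" by auto
    \<comment> \<open>The distance from \<open>x\<close> to \<open>y\<close> is at most
      \<open>\<rho> / l i * norm (F x)\<close>. After multiplication by \<open>l i\<close> the
      growth factor becomes \<open>l i + \<rho> * L\<close>, which is where \<open>B\<close> comes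
      from.\<close>
    have "norm (F y) \<le> norm (F x) + norm (F y - F x)" by norm
    also have "norm (F y - F x) \<le> L * norm (y - x)"
      using lipschitz_onD[OF lip, of y x] by (simp add: dist_norm)
    also have "norm (y - x) = \<rho> / l i * \<bar>f\<bar>" using l \<rho> by (simp add: y_a a_def abs_mult)
    also have "\<bar>f\<bar> \<le> norm (F x)" unfolding f_def by (rule component_le_norm_cart)
    finally have "norm (F y) \<le> norm (F x) + L * (\<rho> / l i * norm (F x))"
      using L \<rho> l by (simp add: mult_left_mono divide_right_mono)
    then have "l i * norm (F y) \<le> (l i + \<rho> * L) * norm (F x)"
      using l by (simp add: field_simps)
    also have "\<dots> \<le> B * norm (F x)" using lB by (rule mult_right_mono) simp
    finally have den: "(l i * norm (F y))\<^sup>2 \<le> (B * norm (F x))\<^sup>2"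
      using l by (intro power_mono) auto
    have "((1 - \<rho>) * f\<^sup>2)\<^sup>2 \<le> (g * f)\<^sup>2" using fg \<rho> by (intro power_mono) auto
    then have num: "\<rho>\<^sup>2 * ((1 - \<rho>) * f\<^sup>2)\<^sup>2 \<le> \<rho>\<^sup>2 * (g * f)\<^sup>2" by (rule mult_left_mono) simp
    have "\<rho>\<^sup>2 * (1 - \<rho>)\<^sup>2 / B\<^sup>2 * (f ^ 4 / (norm (F x))\<^sup>2)
        = \<rho>\<^sup>2 * ((1 - \<rho>) * f\<^sup>2)\<^sup>2 / (B * norm (F x))\<^sup>2"
      by (simp add: power_mult_distrib flip: power_mult)
    also have "\<dots> \<le> \<rho>\<^sup>2 * (g * f)\<^sup>2 / (l i * norm (F y))\<^sup>2"
      using num den l nz by (intro frac_le) auto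
    also have "\<dots> = \<beta> * (a * g)"
      by (simp add: \<beta>_def step_size_def a_def f_def g_def power2_eq_square field_simps)
    finally show ?thesis .
  qed
  with decr show ?thesis unfolding f_def B_def by linarith
qed

section \<open>Dependence of the iterates on the draws\<close>

text \<open>Draw \<open>k\<close> first enters through the selection made at \<open>x k\<close>, so
  \<open>x k\<close> depends only on earlier draws; the independence argument rests on this. The
  conjunct on \<open>ix\<close> carries the induction, since \<open>ix k\<close> feeds the next
  selection.\<close>

lemma watchdog_max_run_determined:
  assumes "watchdog_max_run F l \<rho> \<Omega> sel x0 i0 r ix x y"
    and "watchdog_max_run F l \<rho> \<Omega> sel x0 i0 r' ix' x' y'"
    and "\<And>j. j \<in> {1..k} \<Longrightarrow> r j = r' j"
  shows "x k = x' k \<and> ix k = ix' k \<and> x (Suc k) = x' (Suc k)"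
  using assms(3)
proof (induction k)
  case 0
  then show ?case using assms(1,2) by (simp add: watchdog_max_run_def)
next
  case (Suc k)
  then have "x k = x' k" "ix k = ix' k" "x (Suc k) = x' (Suc k)" by auto
  moreover have "ix (Suc k) = sel (Suc k) (x (Suc k)) (ix k) (r (Suc k))"
    "ix' (Suc k) = sel (Suc k) (x' (Suc k)) (ix' k) (r' (Suc k))"
    using assms(1,2) by (simp_all add: watchdog_max_run_def)
  moreover have "r (Suc k) = r' (Suc k)" using Suc.prems by simp
  ultimately have "ix (Suc k) = ix' (Suc k)" by simp
  then show ?case using \<open>x (Suc k) = x' (Suc k)\<close> assms(1,2)
    by (simp add: watchdog_max_run_def)
qed

text \<open>Any point of \<open>A\<close> with the same tuple of draws may stand in for the given
  one, so \<open>h\<close> can pick one by choice. With \<open>X\<close> written as a function of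
  the tuple, measurability and independence pass from the tuple to \<open>X\<close>.\<close>

lemma factors_through_restrict:
  assumes "\<And>\<omega> \<omega>'. \<omega> \<in> A \<Longrightarrow> \<omega>' \<in> A \<Longrightarrow> (\<And>j. j \<in> J \<Longrightarrow> r j \<omega> = r j \<omega>') \<Longrightarrow> X \<omega> = X \<omega>'"
  obtains h where "\<And>\<omega>. \<omega> \<in> A \<Longrightarrow> X \<omega> = h (\<lambda>j\<in>J. r j \<omega>)"
proof
  fix \<omega> assume \<omega>: "\<omega> \<in> A"
  define \<omega>' where "\<omega>' = (SOME \<omega>'. \<omega>' \<in> A \<and> (\<lambda>j\<in>J. r j \<omega>') = (\<lambda>j\<in>J. r j \<omega>))"
  have "\<omega>' \<in> A \<and> (\<lambda>j\<in>J. r j \<omega>') = (\<lambda>j\<in>J. r j \<omega>)"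
    unfolding \<omega>'_def by (rule someI[of _ \<omega>]) (simp add: \<omega>)
  then have "\<omega>' \<in> A" "\<And>j. j \<in> J \<Longrightarrow> r j \<omega> = r j \<omega>'"
    by (auto simp: restrict_def fun_eq_iff split: if_splits)
  then have "X \<omega> = X \<omega>'" using \<omega> by (intro assms)
  then show "X \<omega> = (\<lambda>p. X (SOME \<omega>'. \<omega>' \<in> A \<and> (\<lambda>j\<in>J. r j \<omega>') = p)) (\<lambda>j\<in>J. r j \<omega>)"
    by (simp add: \<omega>'_def)
qed

section \<open>Expectations of quantities determined by finitely many draws\<close>

context prob_space
begin

context
  fixes r :: "nat \<Rightarrow> 'a \<Rightarrow> 'n::finite" and I J :: "nat set"
  assumes indep: "indep_vars (\<lambda>_. count_space UNIV) r I"
    and J: "finite J" "J \<subseteq> I"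
begin

text \<open>No measurability is assumed of how \<open>X\<close> depends on the draws (the selection function \<open>sel\<close> is
  arbitrary); it is automatic because finitely many draws take finitely many values.\<close>

lemma integrable_determined:
  fixes X :: "'a \<Rightarrow> real"
  assumes "\<And>\<omega> \<omega>'. \<omega> \<in> space M \<Longrightarrow> \<omega>' \<in> space M \<Longrightarrow> (\<And>j. j \<in> J \<Longrightarrow> r j \<omega> = r j \<omega>') \<Longrightarrow> X \<omega> = X \<omega>'"
  shows "integrable M X"
proof -
  obtain h where h: "\<And>\<omega>. \<omega> \<in> space M \<Longrightarrow> X \<omega> = h (\<lambda>j\<in>J. r j \<omega>)"
    using factors_through_restrict[of "space M" J r X] assms by metis
  have r: "r j \<in> measurable M (count_space UNIV)" if "j \<in> J" for j
    using indep J that unfolding indep_vars_def by auto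
  have "(\<lambda>\<omega>. \<lambda>j\<in>J. r j \<omega>) \<in> measurable M (PiM J (\<lambda>_. count_space UNIV))"
    by (rule measurable_restrict) (rule r)
  moreover have eq: "PiM J (\<lambda>_. count_space (UNIV :: 'n set)) = count_space (J \<rightarrow>\<^sub>E UNIV)"
    using J by (intro count_space_PiM_finite) auto
  ultimately have "h \<circ> (\<lambda>\<omega>. \<lambda>j\<in>J. r j \<omega>) \<in> borel_measurable M"
    by (intro measurable_comp) (auto simp: eq)
  then have m: "X \<in> borel_measurable M" by (subst measurable_cong[OF h]) (auto simp: o_def)
  have "finite (X ` space M)"
  proof (rule finite_subset)
    show "X ` space M \<subseteq> h ` (J \<rightarrow>\<^sub>E UNIV)" using h by auto
    show "finite (h ` (J \<rightarrow>\<^sub>E (UNIV :: 'n set)))" using J by (intro finite_imageI finite_PiE) auto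
  qed
  then have "AE \<omega> in M. norm (X \<omega>) \<le> Max (norm ` X ` space M)"
    by (intro AE_I2 Max_ge) auto
  then show ?thesis using m by (rule integrable_const_bound)
qed

text \<open>Splitting by the value of \<open>r k\<close> gives a sum of products of an indicator in
  draw \<open>k\<close> and a function of the draws in \<open>J\<close>. As \<open>k\<close> is not
  in \<open>J\<close>, the factors are independent and each expectation factorises.\<close>

lemma expectation_independent_index:
  fixes X :: "'a \<Rightarrow> 'b" and \<phi> :: "'n \<Rightarrow> 'b \<Rightarrow> real"
  assumes k: "k \<in> I" "k \<notin> J"
    and X: "\<And>\<omega> \<omega>'. \<omega> \<in> space M \<Longrightarrow> \<omega>' \<in> space M \<Longrightarrow> (\<And>j. j \<in> J \<Longrightarrow> r j \<omega> = r j \<omega>') \<Longrightarrow> X \<omega> = X \<omega>'"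
  shows "expectation (\<lambda>\<omega>. \<phi> (r k \<omega>) (X \<omega>))
    = (\<Sum>i\<in>UNIV. prob {\<omega> \<in> space M. r k \<omega> = i} * expectation (\<lambda>\<omega>. \<phi> i (X \<omega>)))"
proof -
  obtain h where h: "\<And>\<omega>. \<omega> \<in> space M \<Longrightarrow> X \<omega> = h (\<lambda>j\<in>J. r j \<omega>)"
    using factors_through_restrict[of "space M" J r X] X by metis
  \<comment> \<open>\<open>X\<close> agrees with \<open>h\<close> of the draws only on
    \<open>space M\<close>; \<open>f\<close> uses \<open>h\<close> throughout, so that it is
    literally a composition with the tuple.\<close>
  define ind f where "ind i \<omega> = (indicator {i} (r k \<omega>) :: real)"
    and "f i \<omega> = \<phi> i (h (\<lambda>j\<in>J. r j \<omega>))" for i \<omega>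
  have f: "f i \<omega> = \<phi> i (X \<omega>)" if "\<omega> \<in> space M" for i \<omega>
    using h[OF that] by (simp add: f_def)
  have rk: "r k \<in> measurable M (count_space UNIV)"
    using indep k unfolding indep_vars_def by auto
  have indep': "indep_var borel (ind i) borel (f i)" for i
  proof -
    have "indep_var (PiM {k} (\<lambda>_. count_space UNIV)) (\<lambda>\<omega>. \<lambda>j\<in>{k}. r j \<omega>)
        (PiM J (\<lambda>_. count_space UNIV)) (\<lambda>\<omega>. \<lambda>j\<in>J. r j \<omega>)"
      using k J by (intro indep_var_restrict[OF indep]) auto
    moreover have "(\<lambda>p. indicator {i} (p k) :: real) \<in> borel_measurable (PiM {k} (\<lambda>_. count_space UNIV))"
      by measurable
    moreover have "(\<lambda>p. \<phi> i (h p)) \<in> borel_measurable (PiM J (\<lambda>_. count_space (UNIV :: 'n set)))"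
      using J by (subst count_space_PiM_finite) auto
    ultimately have "indep_var borel ((\<lambda>p. indicator {i} (p k) :: real) \<circ> (\<lambda>\<omega>. \<lambda>j\<in>{k}. r j \<omega>))
        borel ((\<lambda>p. \<phi> i (h p)) \<circ> (\<lambda>\<omega>. \<lambda>j\<in>J. r j \<omega>))"
      by (rule indep_var_compose)
    then show ?thesis by (simp add: o_def ind_def[abs_def] f_def[abs_def])
  qed
  have int1: "integrable M (ind i)" for i
    unfolding ind_def[abs_def] using rk
    by (intro integrable_const_bound[where B = 1]) (auto simp: indicator_def)
  have int2: "integrable M (f i)" for i
    by (rule integrable_determined) (simp add: f cong: X)
  have E: "expectation (ind i) = prob {\<omega> \<in> space M. r k \<omega> = i}" for i
  proof -
    have "expectation (ind i) = expectation (indicator {\<omega> \<in> space M. r k \<omega> = i})"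
      by (intro Bochner_Integration.integral_cong) (auto simp: indicator_def ind_def)
    then show ?thesis by (simp add: Int_absorb2 Collect_restrict)
  qed
  have "expectation (\<lambda>\<omega>. \<phi> (r k \<omega>) (X \<omega>)) = expectation (\<lambda>\<omega>. \<Sum>i\<in>UNIV. ind i \<omega> * f i \<omega>)"
    by (intro Bochner_Integration.integral_cong) (simp_all add: f ind_def indicator_def)
  also have "\<dots> = (\<Sum>i\<in>UNIV. expectation (\<lambda>\<omega>. ind i \<omega> * f i \<omega>))"
    using indep_var_integrable[OF indep' int1 int2] by (rule Bochner_Integration.integral_sum)
  also have "\<dots> = (\<Sum>i\<in>UNIV. prob {\<omega> \<in> space M. r k \<omega> = i} * expectation (f i))"
    using indep_var_lebesgue_integral[OF indep' int1 int2] by (simp add: E)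
  also have "\<dots> = (\<Sum>i\<in>UNIV. prob {\<omega> \<in> space M. r k \<omega> = i} * expectation (\<lambda>\<omega>. \<phi> i (X \<omega>)))"
    by (intro sum.cong arg_cong2[where f = "(*)"] Bochner_Integration.integral_cong) (simp_all add: f)
  finally show ?thesis .
qed

end

end

section \<open>The residual ratio and the norm of the residual\<close>

lemma residual_ratio_eq:
  "residual_ratio l \<gamma> F x = (\<Sum>i\<in>UNIV. l i powr \<gamma> * ((F x $ i) ^ 4 / (norm (F x))\<^sup>2))"
proof -
  have "(weighted_norm l \<gamma> (vec_square (F x)))\<^sup>2 = (\<Sum>i\<in>UNIV. l i powr \<gamma> * (F x $ i) ^ 4)"
    unfolding weighted_norm_def vec_square_def
    by (subst real_sqrt_pow2) (auto intro!: sum_nonneg simp flip: power_mult)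
  then show ?thesis by (simp add: residual_ratio_def sum_divide_distrib)
qed

lemma residual_ratio_nonneg: "0 \<le> residual_ratio l \<gamma> F x"
  by (simp add: residual_ratio_def)

text \<open>Cauchy-Schwarz against the all-ones vector bounds the squared sum of squares by
  \<open>CARD('n)\<close> times the sum of fourth powers; one factor
  \<open>(norm (F x))\<^sup>2\<close> then cancels.\<close>

lemma power2_norm_le_residual_ratio:
  fixes F :: "real ^ 'n \<Rightarrow> real ^ 'n"
  assumes m: "m > 0" "\<And>i. m \<le> l i powr \<gamma>"
  shows "(norm (F x))\<^sup>2 \<le> real CARD('n) / m * residual_ratio l \<gamma> F x"
proof (cases "F x = 0")
  case False
  let ?N = "(norm (F x))\<^sup>2"
  have N: "?N > 0" using False by simp
  have "?N = (\<Sum>i\<in>UNIV. (F x $ i)\<^sup>2)"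
    by (simp add: norm_vec_def L2_set_def sum_nonneg)
  then have "?N\<^sup>2 \<le> (\<Sum>i\<in>(UNIV::'n set). ((F x $ i)\<^sup>2)\<^sup>2) * (\<Sum>i\<in>(UNIV::'n set). 1\<^sup>2)"
    using Cauchy_Schwarz_ineq_sum[of "\<lambda>i. (F x $ i)\<^sup>2" "\<lambda>_. 1" UNIV] by simp
  then have "?N\<^sup>2 \<le> real CARD('n) * (\<Sum>i\<in>UNIV. (F x $ i) ^ 4)"
    by (simp add: mult.commute flip: power_mult)
  then have "m * ?N\<^sup>2 \<le> m * (real CARD('n) * (\<Sum>i\<in>UNIV. (F x $ i) ^ 4))"
    using m by (intro mult_left_mono) auto
  also have "\<dots> = real CARD('n) * (\<Sum>i\<in>UNIV. m * (F x $ i) ^ 4)"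
    by (simp add: sum_distrib_left mult.left_commute)
  also have "\<dots> \<le> real CARD('n) * (\<Sum>i\<in>UNIV. l i powr \<gamma> * (F x $ i) ^ 4)"
    using m by (intro mult_left_mono sum_mono mult_right_mono) auto
  also have "\<dots> = real CARD('n) * (residual_ratio l \<gamma> F x * ?N)"
    using N by (simp add: residual_ratio_eq sum_distrib_right)
  finally have "(m * ?N) * ?N \<le> (real CARD('n) * residual_ratio l \<gamma> F x) * ?N"
    by (simp add: power2_eq_square mult_ac)
  then have "m * ?N \<le> real CARD('n) * residual_ratio l \<gamma> F x"
    using N by (rule mult_right_le_imp_le)
  then show ?thesis using m by (simp add: field_simps)
qed (simp add: residual_ratio_def)

theorem corollary3p12:
  fixes F :: "real ^ 'n \<Rightarrow> real ^ 'n"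
    and l :: "'n \<Rightarrow> real"
    and L \<rho> \<gamma> :: real
    and \<Omega> :: "(real ^ 'n) set"
    and x_star x0 :: "real ^ 'n"
    and i0 :: 'n
    and sel :: "nat \<Rightarrow> real ^ 'n \<Rightarrow> 'n \<Rightarrow> 'n \<Rightarrow> 'n"
    and M :: "'a measure"
    and r ix :: "nat \<Rightarrow> 'a \<Rightarrow> 'n"
    and x y :: "nat \<Rightarrow> 'a \<Rightarrow> real ^ 'n"
  assumes "monotone_operator F"
    and "L-lipschitz_on UNIV F"
    and "componentwise_lipschitz l F"
    and "\<Omega> \<noteq> {}" and "closed \<Omega>" and "convex \<Omega>"
    and "x_star \<in> \<Omega>" and "F x_star = 0"
    and "0 < \<rho>" and "\<rho> < 1" and "0 \<le> \<gamma>"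
    and "prob_space M"
    and "prob_space.indep_vars M (\<lambda>_. count_space UNIV) r {1..}"
    and "\<And>k i. k \<ge> 1 \<Longrightarrow>
           measure M {\<omega> \<in> space M. r k \<omega> = i} = l i powr \<gamma> / (\<Sum>j\<in>UNIV. l j powr \<gamma>)"
    and "\<And>i. \<bar>F x0 $ i\<bar> \<le> \<bar>F x0 $ i0\<bar>"
    and "max_selection F sel"
    and "\<And>\<omega>. \<omega> \<in> space M \<Longrightarrow>
           watchdog_max_run F l \<rho> \<Omega> sel x0 i0
             (\<lambda>k. r k \<omega>) (\<lambda>k. ix k \<omega>) (\<lambda>k. x k \<omega>) (\<lambda>k. y k \<omega>)"
  shows "(\<forall>K::nat.
            Min ((\<lambda>k. prob_space.expectation M (\<lambda>\<omega>. residual_ratio l \<gamma> F (x k \<omega>))) ` {0..K})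
            \<le> (\<Sum>i\<in>UNIV. l i powr \<gamma>) * (Max (range l) + \<rho> * L)\<^sup>2
                / (\<rho>\<^sup>2 * (1 - \<rho>)\<^sup>2 * (real K + 1)) * (norm (x0 - x_star))\<^sup>2)
       \<and> liminf (\<lambda>k. ereal (prob_space.expectation M (\<lambda>\<omega>. norm (F (x k \<omega>))))) = 0"
proof -
  note mono = assms(1) and lip = assms(2) and cw = assms(3)
  note z = assms(7,8) and \<rho> = assms(9,10) and indep = assms(13) and distr = assms(14)
  note i0_max = assms(15) and sel = assms(16) and run = assms(17)
  interpret prob_space M by fact
  define w where "w i = l i powr \<gamma>" for i
  define S where "S = (\<Sum>i\<in>UNIV. w i)"
  define B where "B = Max (range l) + \<rho> * L"
  define c where "c = \<rho>\<^sup>2 * (1 - \<rho>)\<^sup>2 / B\<^sup>2"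
  define \<phi> where "\<phi> i u = (F u $ i) ^ 4 / (norm (F u))\<^sup>2" for i u
  define d where "d u = (norm (u - x_star))\<^sup>2" for u
  let ?R = "residual_ratio l \<gamma> F"
  have l: "l i > 0" for i using cw by (simp add: componentwise_lipschitz_def)
  have w: "w i > 0" for i using l[of i] by (simp add: w_def)
  have S: "S > 0" unfolding S_def using w by (intro sum_pos) auto
  have B: "B > 0"
  proof -
    have "l i0 \<le> Max (range l)" by simp
    moreover have "0 \<le> \<rho> * L" using lipschitz_on_nonneg[OF lip] \<rho> by simp
    ultimately show ?thesis unfolding B_def using l[of i0] by linarith
  qed
  have c: "c > 0" using \<rho> B by (simp add: c_def)
  have R_eq: "?R u = (\<Sum>i\<in>UNIV. w i * \<phi> i u)" for u
    by (simp add: residual_ratio_eq w_def \<phi>_def)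

  \<comment> \<open>Determinacy and one-step estimates along the run\<close>
  have x0: "x 0 \<omega> = x0" "ix 0 \<omega> = i0" if "\<omega> \<in> space M" for \<omega>
    using run[OF that] by (auto simp: watchdog_max_run_def)
  \<comment> \<open>The half-open range leaves out draw \<open>k\<close>, as needed to make that
    draw independent of \<open>x k\<close>.\<close>
  have x_det: "x k \<omega> = x k \<omega>'"
    if "\<omega> \<in> space M" "\<omega>' \<in> space M" "\<And>j. j \<in> {1..<k} \<Longrightarrow> r j \<omega> = r j \<omega>'" for k \<omega> \<omega>'
  proof (cases k)
    case 0 then show ?thesis using x0 that by simp
  next
    case (Suc m)
    then show ?thesis
      using watchdog_max_run_determined[OF run[OF that(1)] run[OF that(2)], of m] that(3) by auto
  qed
  have int: "integrable M (\<lambda>\<omega>. g (x k \<omega>))" for g :: "real ^ 'n \<Rightarrow> real" and k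
    by (rule integrable_determined[OF indep, of "{1..<k}"]) (auto intro!: arg_cong[where f = g] x_det)
  have step: "c * \<phi> (ix k \<omega>) (x k \<omega>) \<le> d (x k \<omega>) - d (x (Suc k) \<omega>)" if "\<omega> \<in> space M" for k \<omega>
    using run[OF that] unfolding c_def \<phi>_def d_def B_def
    by (intro step_decrease[OF mono lip cw assms(5,6) z \<rho>, where y = "y k \<omega>"])
      (auto simp: watchdog_max_run_def)
  have \<phi>_mono: "\<phi> i u \<le> \<phi> j u" if "\<bar>F u $ i\<bar> \<le> \<bar>F u $ j\<bar>" for i j u
  proof -
    have "\<bar>F u $ i\<bar> ^ 4 \<le> \<bar>F u $ j\<bar> ^ 4" using that by (rule power_mono) simp
    then show ?thesis unfolding \<phi>_def by (intro divide_right_mono) auto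
  qed

  \<comment> \<open>Expected decrease in one iteration\<close>
  have decrease: "c / S * expectation (\<lambda>\<omega>. ?R (x k \<omega>))
      \<le> expectation (\<lambda>\<omega>. d (x k \<omega>)) - expectation (\<lambda>\<omega>. d (x (Suc k) \<omega>))" for k
  proof (cases "k = 0")
    case True
    \<comment> \<open>Iteration 0 uses no draw. The initial index maximises the component, so its
      \<phi> dominates the average of all \<phi> with weights \<open>w i / S\<close>.\<close>
    have "c / S * ?R (x 0 \<omega>) \<le> d (x 0 \<omega>) - d (x (Suc 0) \<omega>)" if \<omega>: "\<omega> \<in> space M" for \<omega>
    proof -
      have "?R (x 0 \<omega>) \<le> (\<Sum>i\<in>UNIV. w i * \<phi> i0 x0)"
        unfolding R_eq x0[OF \<omega>] using i0_max w
        by (intro sum_mono mult_left_mono \<phi>_mono) (auto intro: less_imp_le)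
      then have "?R (x 0 \<omega>) / S \<le> \<phi> i0 x0"
        using S by (simp add: S_def divide_le_eq mult.commute flip: sum_distrib_right)
      then have "c * (?R (x 0 \<omega>) / S) \<le> c * \<phi> i0 x0" using c by (intro mult_left_mono) auto
      then show ?thesis using step[OF \<omega>, of 0] x0[OF \<omega>] by simp
    qed
    then have "expectation (\<lambda>\<omega>. c / S * ?R (x 0 \<omega>)) \<le> expectation (\<lambda>\<omega>. d (x 0 \<omega>) - d (x (Suc 0) \<omega>))"
      using int[of ?R] int[of d]
      by (intro integral_mono integrable_mult_right Bochner_Integration.integrable_diff)
    then show ?thesis using True int[of d] by simp
  next
    case False
    \<comment> \<open>The range now includes \<open>k\<close>, because the integrand also involves
      draw \<open>k\<close>.\<close>
    have int_drawn: "integrable M (\<lambda>\<omega>. \<phi> (r k \<omega>) (x k \<omega>))"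
      using False
      by (intro integrable_determined[OF indep, of "{1..k}"]) (auto intro!: arg_cong2[where f = \<phi>] x_det)
    have "expectation (\<lambda>\<omega>. \<phi> (r k \<omega>) (x k \<omega>))
        = (\<Sum>i\<in>UNIV. prob {\<omega> \<in> space M. r k \<omega> = i} * expectation (\<lambda>\<omega>. \<phi> i (x k \<omega>)))"
      using False by (intro expectation_independent_index[OF indep, of "{1..<k}"]) (auto intro: x_det)
    also have "\<dots> = (\<Sum>i\<in>UNIV. w i * expectation (\<lambda>\<omega>. \<phi> i (x k \<omega>))) / S"
      using False distr[of k] by (simp add: w_def S_def sum_divide_distrib)
    also have "(\<Sum>i\<in>UNIV. w i * expectation (\<lambda>\<omega>. \<phi> i (x k \<omega>))) = expectation (\<lambda>\<omega>. ?R (x k \<omega>))"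
      unfolding R_eq using int by (subst Bochner_Integration.integral_sum) auto
    finally have avg: "expectation (\<lambda>\<omega>. \<phi> (r k \<omega>) (x k \<omega>)) = expectation (\<lambda>\<omega>. ?R (x k \<omega>)) / S" .
    have "c * \<phi> (r k \<omega>) (x k \<omega>) \<le> d (x k \<omega>) - d (x (Suc k) \<omega>)" if \<omega>: "\<omega> \<in> space M" for \<omega>
    proof -
      have "ix k \<omega> = sel k (x k \<omega>) (ix (k - 1) \<omega>) (r k \<omega>)"
        using run[OF \<omega>] False by (auto simp: watchdog_max_run_def)
      then have "\<phi> (r k \<omega>) (x k \<omega>) \<le> \<phi> (ix k \<omega>) (x k \<omega>)"
        using sel by (intro \<phi>_mono) (simp add: max_selection_def)
      then have "c * \<phi> (r k \<omega>) (x k \<omega>) \<le> c * \<phi> (ix k \<omega>) (x k \<omega>)" using c by simp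
      then show ?thesis using step[OF \<omega>, of k] by linarith
    qed
    then have "expectation (\<lambda>\<omega>. c * \<phi> (r k \<omega>) (x k \<omega>))
        \<le> expectation (\<lambda>\<omega>. d (x k \<omega>) - d (x (Suc k) \<omega>))"
      using int_drawn int[of d]
      by (intro integral_mono integrable_mult_right Bochner_Integration.integrable_diff)
    then show ?thesis using avg int[of d] by simp
  qed

  \<comment> \<open>Telescoping the expected decrease\<close>
  define E where "E k = expectation (\<lambda>\<omega>. ?R (x k \<omega>))" for k
  have E0: "0 \<le> E k" for k unfolding E_def by (simp add: residual_ratio_nonneg)
  \<comment> \<open>This is \<open>S / c\<close> times the initial squared distance: the telescoped
    total divided by the decrease constant \<open>c / S\<close>.\<close>
  define C where "C = S * B\<^sup>2 / (\<rho>\<^sup>2 * (1 - \<rho>)\<^sup>2) * (norm (x0 - x_star))\<^sup>2"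
  have sum_le: "(\<Sum>k<N. E k) \<le> C" for N
  proof -
    have "c / S * (\<Sum>k<N. E k)
        \<le> (\<Sum>k<N. expectation (\<lambda>\<omega>. d (x k \<omega>)) - expectation (\<lambda>\<omega>. d (x (Suc k) \<omega>)))"
      unfolding sum_distrib_left E_def by (intro sum_mono decrease)
    also have "\<dots> = expectation (\<lambda>\<omega>. d (x 0 \<omega>)) - expectation (\<lambda>\<omega>. d (x N \<omega>))"
      by (rule sum_lessThan_telescope')
    also have "\<dots> \<le> expectation (\<lambda>\<omega>. d (x 0 \<omega>))" by (simp add: d_def)
    also have "\<dots> = expectation (\<lambda>\<omega>. d x0)"
      by (intro Bochner_Integration.integral_cong) (simp_all add: x0)
    also have "\<dots> = (norm (x0 - x_star))\<^sup>2" by (simp add: d_def prob_space)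
    finally have "(\<Sum>k<N. E k) \<le> S / c * (norm (x0 - x_star))\<^sup>2"
      using c S by (simp add: field_simps)
    then show ?thesis by (simp add: C_def c_def)
  qed

  \<comment> \<open>Rate for the smallest expected ratio\<close>
  have "Min (E ` {0..K}) \<le> S * B\<^sup>2 / (\<rho>\<^sup>2 * (1 - \<rho>)\<^sup>2 * (real K + 1)) * (norm (x0 - x_star))\<^sup>2" for K
  proof -
    have "(\<Sum>k<Suc K. Min (E ` {0..K})) \<le> (\<Sum>k<Suc K. E k)"
      by (intro sum_mono Min_le) auto
    then have "(real K + 1) * Min (E ` {0..K}) \<le> C"
      using sum_le[of "Suc K"] by (simp add: algebra_simps)
    then have "Min (E ` {0..K}) \<le> C / (real K + 1)" by (simp add: le_divide_eq mult.commute)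
    then show ?thesis by (simp add: C_def)
  qed

  \<comment> \<open>Convergence of the expected residual norm\<close>
  moreover have "(\<lambda>k. expectation (\<lambda>\<omega>. norm (F (x k \<omega>)))) \<longlonglongrightarrow> 0"
  proof -
    define m where "m = Min (range w)"
    have m: "m > 0" "\<And>i. m \<le> l i powr \<gamma>"
      unfolding m_def using w by (auto simp flip: w_def)
    define A where "A = real CARD('n) / m"
    have "(\<lambda>k. sqrt (A * E k)) \<longlonglongrightarrow> 0"
    proof -
      \<comment> \<open>Bounded partial sums of nonnegative terms force \<open>E\<close> itself to
        tend to 0, so the lower limit is obtained as a genuine limit.\<close>
      have "summable E" using E0 sum_le by (rule summableI_nonneg_bounded)
      then have "E \<longlonglongrightarrow> 0" by (rule summable_LIMSEQ_zero)
      then have "(\<lambda>k. sqrt (A * E k)) \<longlonglongrightarrow> sqrt (A * 0)" by (intro tendsto_intros)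
      then show ?thesis by simp
    qed
    moreover have "expectation (\<lambda>\<omega>. norm (F (x k \<omega>))) \<le> sqrt (A * E k)" for k
    proof -
      \<comment> \<open>Nonnegativity of the variance serves as Cauchy-Schwarz on the probability
        space.\<close>
      have "(expectation (\<lambda>\<omega>. norm (F (x k \<omega>))))\<^sup>2 \<le> expectation (\<lambda>\<omega>. (norm (F (x k \<omega>)))\<^sup>2)"
        using variance_positive[of "\<lambda>\<omega>. norm (F (x k \<omega>))"]
          variance_eq[OF int[of "\<lambda>u. norm (F u)" k] int[of "\<lambda>u. (norm (F u))\<^sup>2" k]] by simp
      also have "\<dots> \<le> expectation (\<lambda>\<omega>. A * ?R (x k \<omega>))"
        unfolding A_def
        using int[of ?R k] int[of "\<lambda>u. (norm (F u))\<^sup>2" k]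
        by (intro integral_mono integrable_mult_right power2_norm_le_residual_ratio m)
      also have "\<dots> = A * E k" by (simp add: E_def)
      finally show ?thesis by (rule real_le_rsqrt)
    qed
    ultimately show ?thesis
      by (auto intro: tendsto_sandwich[where f = "\<lambda>_. 0" and h = "\<lambda>k. sqrt (A * E k)"])
  qed
  then have "liminf (\<lambda>k. ereal (expectation (\<lambda>\<omega>. norm (F (x k \<omega>))))) = ereal 0"
    by (intro lim_imp_Liminf tendsto_ereal) auto
  ultimately show ?thesis
    unfolding E_def S_def w_def B_def by (simp add: zero_ereal_def)
qed

end
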